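(* For every integer $d\geqslant 2$, we have $\mathrm{bp}_2(K_{b(d)})\leqslant d$.
   Context: $K_N$ denotes the complete graph on $N$ vertices. A bipartite clique in $K_N$ is a complete bipartite subgraph of $K_N$ with two non-empty parts. A bipartite $2$-covering of $K_N$ is a family of bipartite cliques in $K_N$ such that every edge of $K_N$ belongs to at least one and at most two members of the family. $\mathrm{bp}_2(K_N)$ is the least number of bipartite cliques in a bipartite $2$-covering of $K_N$. Let $(a(n))_{n\geqslant 1}$ be the non-decreasing sequence of integers that lists every integer $m\geqslant 2$, where each $m$ of the form $3\cdot 2^r$ ($r\geqslant 0$ an integer) appears exactly twice and every other $m\geqslant 2$ appears exactly once; thus $a=2,3,3,4,5,6,6,7,8,\dots$. Define $b(2)=4$ and $b(d)=4+a(1)+\cdots+a(d-2)$ for $d\geqslant 3$. *)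

theory Defs
  imports "Graph_Theory.Graph_Theory" "HOL-Library.Multiset"
begin

text \<open>
  An undirected graph is a symmetric digraph without loops and parallel arcs (locale graph), so
  an edge between \<open>u\<close> and \<open>v\<close> is the pair of arc ends \<open>(u, v)\<close>, \<open>(v, u)\<close>.
\<close>

definition bipartite_clique :: "('a, 'b) pre_digraph \<Rightarrow> ('a, 'b) pre_digraph \<Rightarrow> bool" where
  "bipartite_clique G H \<longleftrightarrow>
     subgraph H G \<and> (\<exists>m n. m \<ge> 1 \<and> n \<ge> 1 \<and> complete_bipartite_digraph m n H)"

text \<open>
  Families are finite multisets, so a repeated member counts with its multiplicity. Members are
  symmetric, so both ends \<open>(u, v)\<close> and \<open>(v, u)\<close> of an edge lie in the same members.
\<close>

definition bipartite_2_covering ::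
    "('a, 'b) pre_digraph \<Rightarrow> ('a, 'b) pre_digraph multiset \<Rightarrow> bool" where
  "bipartite_2_covering G M \<longleftrightarrow>
     (\<forall>H \<in># M. bipartite_clique G H) \<and>
     (\<forall>e \<in> arcs_ends G. 1 \<le> size {#H \<in># M. e \<in> arcs_ends H#} \<and>
                        size {#H \<in># M. e \<in> arcs_ends H#} \<le> 2)"

definition bp2 :: "('a, 'b) pre_digraph \<Rightarrow> nat" where
  "bp2 G = (LEAST k. \<exists>M. bipartite_2_covering G M \<and> size M = k)"

text \<open>
  The sequence is indexed from 1; the value at 0 is irrelevant. The value 0 of \<open>card\<close> on infinite
  sets does no harm, since the prescribed cardinalities are positive.
\<close>

definition is_sequence_a :: "(nat \<Rightarrow> nat) \<Rightarrow> bool" where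
  "is_sequence_a a \<longleftrightarrow>
     mono_on {1..} a \<and> (\<forall>n\<ge>1. a n \<ge> 2) \<and>
     (\<forall>m\<ge>2. card {n. n \<ge> 1 \<and> a n = m} = (if \<exists>r. m = 3 * 2 ^ r then 2 else 1))"

text \<open>For \<open>d = 2\<close> the sum is empty.\<close>

definition b :: "(nat \<Rightarrow> nat) \<Rightarrow> nat \<Rightarrow> nat" where
  "b a d = 4 + (\<Sum>i = 1..d - 2. a i)"

text \<open>
  The minimum defining \<open>bp2\<close> is over a nonempty set: the single edges form a covering.
\<close>

lemma bipartite_2_covering_exists:
  assumes "graph G"
  shows "\<exists>M. bipartite_2_covering G M"
proof -
  interpret graph G by fact
  define h where "h = (\<lambda>(u, v). \<lparr>verts = {u, v},
    arcs = {e \<in> arcs G. {tail G e, head G e} = {u, v}}, tail = tail G, head = head G\<rparr>)"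
  have ends: "arcs_ends (h (u, v)) = {(u, v), (v, u)}" if uv: "(u, v) \<in> arcs_ends G" for u v
  proof -
    have "(v, u) \<in> arcs_ends G"
      using uv sym_arcs by (auto simp: symmetric_def sym_def)
    then show ?thesis
      using uv by (auto simp: h_def arcs_ends_conv doubleton_eq_iff image_iff)
  qed
  have bc: "bipartite_clique G (h (u, v))" if uv: "(u, v) \<in> arcs_ends G" for u v
  proof -
    have ne: "u \<noteq> v" and inG: "u \<in> verts G" "v \<in> verts G"
      using uv no_loops by (auto simp: arcs_ends_conv)
    have wf: "wf_digraph (h (u, v))"
      by unfold_locales (auto simp: h_def)
    have "subgraph (h (u, v)) G"
      using inG wf wf_digraph unfolding subgraph_def compatible_def by (auto simp: h_def)
    moreover have "graph (h (u, v))"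
    proof -
      have "digraph (h (u, v))"
        by unfold_locales (use no_loops no_multi_arcs in \<open>auto simp: h_def arc_to_ends_def\<close>)
      moreover have "symmetric (h (u, v))"
        using ends[OF uv] by (auto simp: symmetric_def sym_def)
      ultimately show ?thesis by (rule digraph.graphI)
    qed
    then have "complete_bipartite_digraph 1 1 (h (u, v))"
      unfolding complete_bipartite_digraph_def ends[OF uv]
      using ne by (intro conjI exI[of _ "{u}"] exI[of _ "{v}"]) (auto simp: h_def)
    ultimately show ?thesis
      unfolding bipartite_clique_def by blast
  qed
  define M where "M = mset_set (h ` arcs_ends G)"
  have fin: "finite (h ` arcs_ends G)"
    by (simp add: arcs_ends_def)
  have "size {#H \<in># M. e \<in> arcs_ends H#} = 1" if e: "e \<in> arcs_ends G" for e
  proof -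
    obtain u v where uv: "e = (u, v)" by (cases e)
    have swap: "h (u, v) = h (v, u)"
      by (simp add: h_def insert_commute)
    have "{H \<in> h ` arcs_ends G. e \<in> arcs_ends H} = {h e}"
    proof (rule equalityI; rule subsetI)
      fix H assume H: "H \<in> {H \<in> h ` arcs_ends G. e \<in> arcs_ends H}"
      then obtain x y where xy: "H = h (x, y)" "(x, y) \<in> arcs_ends G"
        by (metis (no_types, lifting) imageE mem_Collect_eq surj_pair)
      have "(u, v) \<in> {(x, y), (y, x)}"
        using H unfolding xy(1) uv mem_Collect_eq ends[OF xy(2)] by blast
      then have "u = x \<and> v = y \<or> u = y \<and> v = x"
        by simp
      then show "H \<in> {h e}"
        using swap xy(1) uv by (metis singletonI)
    next
      fix H assume "H \<in> {h e}"
      moreover have "e \<in> arcs_ends (h e)"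
        using ends e unfolding uv by blast
      ultimately show "H \<in> {H \<in> h ` arcs_ends G. e \<in> arcs_ends H}"
        using e by blast
    qed
    then show ?thesis
      using fin by (simp add: M_def)
  qed
  then have "bipartite_2_covering G M"
    unfolding bipartite_2_covering_def using bc fin by (auto simp: M_def)
  then show ?thesis ..
qed

lemma is_sequence_a_exists: "\<exists>a. is_sequence_a a"
proof -
  define w :: "nat \<Rightarrow> nat" where
    "w m = (if m < 2 then 0 else if \<exists>r. m = 3 * 2 ^ r then 2 else 1)" for m
  define c where "c m = (\<Sum>k\<le>m. w k)" for m
  define a where "a n = (LEAST m. n \<le> c m)" for n
  have ge: "m \<le> c (Suc m)" for m
    by (induction m) (auto simp: c_def w_def)
  have c_mono: "mono c"
    by (rule mono_iff_le_Suc[THEN iffD2]) (simp add: c_def)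
  have a_le: "a n \<le> m \<longleftrightarrow> n \<le> c m" for n m
  proof
    have "n \<le> c (a n)"
      unfolding a_def by (rule LeastI[of _ "Suc n"]) (rule ge)
    then show "a n \<le> m \<Longrightarrow> n \<le> c m"
      using c_mono by (meson monoD order_trans)
  qed (simp add: a_def Least_le)
  have c1: "c (Suc 0) = 0"
    by (simp add: c_def w_def)
  have "mono_on {1..} a"
    by (rule mono_onI) (metis a_le order_refl order_trans)
  moreover have "a n \<ge> 2" if "n \<ge> 1" for n
    using that a_le[of n "Suc 0"] c1 by linarith
  moreover have "card {n. n \<ge> 1 \<and> a n = m} = (if \<exists>r. m = 3 * 2 ^ r then 2 else 1)"
    if m: "m \<ge> 2" for m
  proof -
    obtain k where k: "m = Suc k" using m by (cases m) auto
    have "a n = m \<longleftrightarrow> c k < n \<and> n \<le> c m" for n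
      using a_le[of n k] a_le[of n m] k by linarith
    then have eq: "n \<ge> 1 \<and> a n = m \<longleftrightarrow> n \<in> {c k<..c m}" for n
      by (metis One_nat_def Suc_leI greaterThanAtMost_iff gr_zeroI not_less_zero)
    have "card {n. n \<ge> 1 \<and> a n = m} = c m - c k"
      unfolding eq Collect_mem_eq by (rule card_greaterThanAtMost)
    also have "\<dots> = w m"
      by (simp add: k c_def)
    finally have "card {n. n \<ge> 1 \<and> a n = m} = w m" .
    then show ?thesis
      unfolding w_def using m by simp
  qed
  ultimately show ?thesis
    unfolding is_sequence_a_def by blast
qed

end

theory Submission
  imports Defs
begin

text \<open>
  A covering by \<open>d\<close> bipartite cliques assigns to every vertex a word in \<open>{0, 1, *}\<^sup>d\<close> such that two
  distinct words clash (have a 0 against a 1) in one or two coordinates. The words are indexed by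
  the edges of a complete multipartite graph, where the words of adjacent edges clash exactly once.
  Doubling a vertex \<open>x\<close> (each edge \<open>xy\<close> becomes \<open>xy\<close> and \<open>x'y\<close>) costs one new coordinate. A variant
  of this step leads from the complete graph on \<open>2^j + 1\<close> vertices to the one on \<open>2^(j+1) + 1\<close>
  vertices with \<open>2^j + 1\<close> new coordinates, so the former needs \<open>2^j + j - 1\<close> coordinates. Further
  doublings give the Turan graph with \<open>2^j + 1\<close> parts on \<open>d + 2 - j\<close> vertices in dimension \<open>d\<close>. For
  \<open>2^(j+1) + j \<le> d \<le> 2^(j+2) + j + 1\<close> it has exactly \<open>b(d)\<close> edges: adding the vertex number \<open>n\<close>
  adds \<open>n - n div (2^j + 1)\<close> edges, and the values \<open>3 * 2^r\<close> repeated in \<open>a\<close> are where this quotient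
  jumps from 2 to 3; at the ends of the ranges the edge numbers for \<open>j\<close> and \<open>j + 1\<close> agree.
\<close>

section \<open>Words and edge labellings\<close>

text \<open>\<open>None\<close> stands for the symbol \<open>*\<close>.\<close>

definition clash :: "bool option \<Rightarrow> bool option \<Rightarrow> bool" where
  "clash p q \<longleftrightarrow> p \<noteq> None \<and> q \<noteq> None \<and> p \<noteq> q"

definition clashes :: "nat \<Rightarrow> (nat \<Rightarrow> bool option) \<Rightarrow> (nat \<Rightarrow> bool option) \<Rightarrow> nat" where
  "clashes d w w' = card {i. i < d \<and> clash (w i) (w' i)}"

text \<open>Clashes plus common vertices, rather than clashes alone, stay bounded under doubling:
  the adjacent edges \<open>{x, y}\<close> and \<open>{x, y'}\<close> may become the disjoint
  \<open>{x, y}\<close> and \<open>{x', y'}\<close>, which gain a clash and lose the common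
  vertex.\<close>

definition edge_labelling :: "nat \<Rightarrow> 'a set set \<Rightarrow> ('a set \<Rightarrow> nat \<Rightarrow> bool option) \<Rightarrow> bool" where
  "edge_labelling d E f \<longleftrightarrow> (\<forall>e\<in>E. \<forall>e'\<in>E. e \<noteq> e' \<longrightarrow>
     1 \<le> clashes d (f e) (f e') \<and> clashes d (f e) (f e') + card (e \<inter> e') \<le> 2)"

lemma clash_simps [simp]:
  "\<not> clash p p" "\<not> clash None p" "\<not> clash p None" "clash (Some s) (Some t) \<longleftrightarrow> s \<noteq> t"
  by (auto simp: clash_def)

lemma clashes_self [simp]: "clashes d w w = 0"
  by (simp add: clashes_def)

lemma clashes_upd:
  "clashes (Suc d) (w(d := p)) (w'(d := q)) = clashes d w w' + of_bool (clash p q)"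
proof -
  have "{i. i < Suc d \<and> clash ((w(d := p)) i) ((w'(d := q)) i)} =
      {i. i < d \<and> clash (w i) (w' i)} \<union> (if clash p q then {d} else {})"
    by (auto simp: less_Suc_eq)
  then show ?thesis
    by (simp add: clashes_def)
qed

section \<open>Doubling a vertex\<close>

text \<open>By \<open>le\<close> a new clash is paid for by an additional common vertex of the
  images. Edges with equal images inherit the same word, so their only clash is the new one, and
  \<open>card2\<close> gives the bound 2.\<close>

lemma edge_labelling_pullback:
  assumes f: "edge_labelling d E f"
    and g: "g ` E' \<subseteq> E"
    and card2: "\<And>e. e \<in> E \<Longrightarrow> card e \<le> 2"
    and le: "\<And>e e'. e \<in> E' \<Longrightarrow> e' \<in> E' \<Longrightarrow> e \<noteq> e' \<Longrightarrow>
      of_bool (clash (c e) (c e')) + card (e \<inter> e') \<le> card (g e \<inter> g e')"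
    and sep: "\<And>e e'. e \<in> E' \<Longrightarrow> e' \<in> E' \<Longrightarrow> e \<noteq> e' \<Longrightarrow> g e = g e' \<Longrightarrow> clash (c e) (c e')"
  shows "edge_labelling (Suc d) E' (\<lambda>e. (f (g e))(d := c e))"
  unfolding edge_labelling_def
proof (intro ballI impI)
  fix e e' assume e: "e \<in> E'" "e' \<in> E'" "e \<noteq> e'"
  then have gE: "g e \<in> E" "g e' \<in> E" using g by auto
  let ?n = "clashes (Suc d) ((f (g e))(d := c e)) ((f (g e'))(d := c e'))"
  show "1 \<le> ?n \<and> ?n + card (e \<inter> e') \<le> 2"
  proof (cases "g e = g e'")
    case True
    then show ?thesis
      using sep[OF e] le[OF e] card2[OF gE(1)] by (simp add: clashes_upd)
  next
    case False
    then have "1 \<le> clashes d (f (g e)) (f (g e'))"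
        "clashes d (f (g e)) (f (g e')) + card (g e \<inter> g e') \<le> 2"
      using f gE by (auto simp: edge_labelling_def)
    then show ?thesis
      using le[OF e] by (simp add: clashes_upd)
  qed
qed

text \<open>
  The vertex \<open>x\<close> is doubled into \<open>x\<close> and \<open>x'\<close>, which the new coordinate tells apart. An edge
  between the two copies can be added for free if it takes over the word of an edge \<open>{z, x}\<close> that
  is given up.
\<close>

lemma edge_labelling_split:
  fixes x x' z :: 'a
  assumes f: "edge_labelling d E f"
    and E: "\<And>e. e \<in> E \<Longrightarrow> card e = 2"
    and E': "\<And>e. e \<in> E' \<Longrightarrow> card e = 2"
    and ne: "x \<noteq> x'" "z \<noteq> x" "z \<noteq> x'"
    and img: "\<And>e. e \<in> E' \<Longrightarrow> e \<noteq> {x, x'} \<Longrightarrow> id(x' := x) ` e \<in> E"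
    and new: "{x, x'} \<in> E' \<Longrightarrow> {z, x} \<in> E \<and> {z, x} \<notin> E' \<and> {z, x'} \<notin> E'"
  shows "\<exists>f'. edge_labelling (Suc d) E' f'"
proof -
  define \<pi> where "\<pi> = id(x' := x)"
  \<comment> \<open>\<open>\<pi>\<close> would collapse \<open>{x, x'}\<close> to one vertex, so
    this edge takes the word of \<open>{z, x}\<close> with new letter \<open>None\<close>.\<close>
  define g where "g e = (if e = {x, x'} then {z, x} else \<pi> ` e)" for e
  define c where "c e = (if e = {x, x'} then None else if x \<in> e then Some False
    else if x' \<in> e then Some True else None)" for e
  have both: "x \<notin> e \<or> x' \<notin> e" if e: "e \<in> E'" "e \<noteq> {x, x'}" for e
  proof (rule ccontr)
    assume "\<not> ?thesis"
    then show False using E'[OF e(1)] e(2) ne by (auto simp: card_2_iff)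
  qed
  have fin: "finite e" if "e \<in> E'" for e
    using E'[OF that] by (simp add: card_ge_0_finite)
  have new_le: "card ({x, x'} \<inter> e) \<le> card ({z, x} \<inter> \<pi> ` e)"
    if e: "e \<in> E'" "e \<noteq> {x, x'}" for e
  proof (cases "x \<in> e \<or> x' \<in> e")
    case True
    then have "x \<in> {z, x} \<inter> \<pi> ` e" by (auto simp: \<pi>_def image_iff)
    then have "1 \<le> card ({z, x} \<inter> \<pi> ` e)"
      by (metis One_nat_def Suc_leI card_gt_0_iff empty_iff finite.emptyI finite.insertI finite_Int)
    moreover have "card ({x, x'} \<inter> e) \<le> 1"
      using both[OF e] by (auto simp: Int_insert_left)
    ultimately show ?thesis by simp
  qed auto
  \<comment> \<open>If the new letters clash, one edge contains \<open>x\<close> and the other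
    \<open>x'\<close>; the images then share \<open>x\<close>, which is not the image of a common
    vertex.\<close>
  have old_le: "of_bool (clash (c e) (c e')) + card (e \<inter> e') \<le> card (\<pi> ` e \<inter> \<pi> ` e')"
    if e: "e \<in> E'" "e \<noteq> {x, x'}" "e' \<in> E'" "e' \<noteq> {x, x'}" for e e'
  proof -
    have "inj_on \<pi> e"
      using both[OF e(1,2)] by (auto simp: \<pi>_def inj_on_def split: if_splits)
    then have eq: "card (\<pi> ` (e \<inter> e')) = card (e \<inter> e')"
      by (meson card_image inf_le1 inj_on_subset)
    have sub: "\<pi> ` (e \<inter> e') \<subseteq> \<pi> ` e \<inter> \<pi> ` e'" by auto
    have fin': "finite (\<pi> ` e \<inter> \<pi> ` e')" using fin e by auto
    show ?thesis
    proof (cases "clash (c e) (c e')")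
      case True
      then have "x \<in> e \<and> x' \<in> e' \<or> x' \<in> e \<and> x \<in> e'"
        by (auto simp: c_def split: if_splits)
      then have "x \<in> \<pi> ` e \<inter> \<pi> ` e' - \<pi> ` (e \<inter> e')"
        using both[OF e(1,2)] both[OF e(3,4)] by (auto simp: \<pi>_def image_iff split: if_splits)
      then have "\<pi> ` (e \<inter> e') \<subset> \<pi> ` e \<inter> \<pi> ` e'" using sub by blast
      from psubset_card_mono[OF fin' this] show ?thesis
        using True eq by simp
    next
      case False
      then show ?thesis using card_mono[OF fin' sub] eq by simp
    qed
  qed
  have "edge_labelling (Suc d) E' (\<lambda>e. (f (g e))(d := c e))"
  proof (rule edge_labelling_pullback[OF f])
    show "g ` E' \<subseteq> E" using img new by (auto simp: g_def \<pi>_def)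
    show "card e \<le> 2" if "e \<in> E" for e using E[OF that] by simp
    fix e e' assume e: "e \<in> E'" "e' \<in> E'" "e \<noteq> e'"
    consider "e = {x, x'}" "e' \<noteq> {x, x'}" | "e' = {x, x'}" "e \<noteq> {x, x'}"
      | "e \<noteq> {x, x'}" "e' \<noteq> {x, x'}" using e by auto
    then show "of_bool (clash (c e) (c e')) + card (e \<inter> e') \<le> card (g e \<inter> g e')"
    proof cases
      case 1
      then have "c e = None" "g e = {z, x}" "g e' = \<pi> ` e'" by (simp_all add: c_def g_def)
      then show ?thesis using new_le[OF e(2)] 1 by simp
    next
      case 2
      then have "c e' = None" "g e' = {z, x}" "g e = \<pi> ` e" by (simp_all add: c_def g_def)
      then show ?thesis using new_le[OF e(1)] 2 by (simp add: Int_commute)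
    next
      case 3
      then show ?thesis using old_le e by (simp add: g_def)
    qed
    have ne_img: "\<pi> ` a \<noteq> {z, x}" if "a \<in> E'" "{x, x'} \<in> E'" for a
    proof
      assume "\<pi> ` a = {z, x}"
      then have "z \<in> a" "x \<in> a \<or> x' \<in> a" "a \<subseteq> {z, x, x'}"
        using ne by (auto simp: \<pi>_def image_iff set_eq_iff split: if_splits)
      then have "a = {z, x} \<or> a = {z, x'}"
        using E'[OF that(1)] ne by (auto simp: card_2_iff)
      then show False using new that by auto
    qed
    show "clash (c e) (c e')" if "g e = g e'"
    proof -
      have nn: "e \<noteq> {x, x'}" "e' \<noteq> {x, x'}"
        using that ne_img e by (metis g_def)+
      then have eq: "\<pi> ` e = \<pi> ` e'" using that by (simp add: g_def)
      have *: "\<pi> ` a - {x} = a - {x, x'}" "x \<in> \<pi> ` a \<longleftrightarrow> x \<in> a \<or> x' \<in> a" for a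
        by (auto simp: \<pi>_def image_iff split: if_splits)
      have "e - {x, x'} = e' - {x, x'}" "x \<in> e \<or> x' \<in> e \<longleftrightarrow> x \<in> e' \<or> x' \<in> e'"
        using * eq by metis+
      then have "x \<in> e \<and> x' \<in> e' \<or> x' \<in> e \<and> x \<in> e'"
        using e(3) by (cases "x \<in> e"; cases "x' \<in> e"; cases "x \<in> e'"; cases "x' \<in> e'") auto
      then show ?thesis
        using both[OF e(1) nn(1)] both[OF e(2) nn(2)] nn by (auto simp: c_def)
    qed
  qed
  then show ?thesis by blast
qed

section \<open>Labelling complete graphs on \<open>2 ^ j + 1\<close> vertices\<close>

definition complete_edges :: "nat \<Rightarrow> nat set set" where
  "complete_edges k = {{u, v} | u v. u < k \<and> v < k \<and> u \<noteq> v}"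

text \<open>With residue classes as parts, the graphs for growing \<open>n\<close> extend each
  other, and vertex \<open>n\<close> joins the part of \<open>n - k\<close>.\<close>

definition turan_edges :: "nat \<Rightarrow> nat \<Rightarrow> nat set set" where
  "turan_edges n k = {{u, v} | u v. u < n \<and> v < n \<and> u mod k \<noteq> v mod k}"

text \<open>Vertex \<open>s\<close> is doubled into \<open>s\<close> and \<open>k\<close>, and
  \<open>{s, k}\<close> takes over the word of \<open>{z, s}\<close>: the complete graph gains a
  vertex and \<open>z\<close> loses a neighbour.\<close>

lemma complete_edges_split:
  assumes "edge_labelling d (complete_edges k \<union> {{z, v} | v. v < Suc s}) f" "s < k" "k < z"
  shows "\<exists>f'. edge_labelling (Suc d) (complete_edges (Suc k) \<union> {{z, v} | v. v < s}) f'"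
proof (rule edge_labelling_split[OF assms(1), where x = s and x' = k and z = z])
  show "card e = 2" if "e \<in> complete_edges k \<union> {{z, v} | v. v < Suc s}" for e
    using that assms(2,3) by (auto simp: complete_edges_def)
  show "card e = 2" if "e \<in> complete_edges (Suc k) \<union> {{z, v} | v. v < s}" for e
    using that assms(2,3) by (auto simp: complete_edges_def)
  show "(id(k := s)) ` e \<in> complete_edges k \<union> {{z, v} | v. v < Suc s}"
    if "e \<in> complete_edges (Suc k) \<union> {{z, v} | v. v < s}" "e \<noteq> {s, k}" for e
    using that(1)
  proof
    assume "e \<in> complete_edges (Suc k)"
    then obtain u v where e: "e = {u, v}" "u < Suc k" "v < Suc k" "u \<noteq> v"
      by (auto simp: complete_edges_def)
    have "(id(k := s)) ` e = {(id(k := s)) u, (id(k := s)) v}"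
      unfolding e(1) by (simp only: image_insert image_empty)
    moreover have "(id(k := s)) u \<noteq> (id(k := s)) v"
      using e that(2) by (auto split: if_splits)
    moreover have "(id(k := s)) u < k" "(id(k := s)) v < k" using e assms(2) by auto
    ultimately have "(id(k := s)) ` e \<in> complete_edges k"
      unfolding complete_edges_def by blast
    then show ?thesis ..
  next
    assume "e \<in> {{z, v} | v. v < s}"
    then show ?thesis using assms(2,3) by auto
  qed
qed (use assms(2,3) in \<open>auto simp: complete_edges_def doubleton_eq_iff\<close>)

text \<open>The vertices from \<open>s - 1\<close> down to 0 are doubled in turn;
  \<open>k + s \<le> z\<close> keeps the new vertices apart from \<open>z\<close>, which ends up
  isolated.\<close>

lemma complete_edges_split_all:
  assumes "edge_labelling d (complete_edges k \<union> {{z, v} | v. v < s}) f" "s \<le> k" "k + s \<le> z"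
  shows "\<exists>f'. edge_labelling (d + s) (complete_edges (k + s)) f'"
  using assms
proof (induction s arbitrary: d k f)
  case 0
  then show ?case by auto
next
  case (Suc s)
  obtain f' where "edge_labelling (Suc d) (complete_edges (Suc k) \<union> {{z, v} | v. v < s}) f'"
    using complete_edges_split[OF Suc.prems(1)] Suc.prems(2,3) by auto
  from Suc.IH[OF this] Suc.prems(2,3) show ?case by simp
qed

text \<open>
  Doubling the last vertex first gives a vertex \<open>z\<close> joined to all others, whose edges are then
  given up one by one.
\<close>

lemma complete_edges_double:
  assumes "edge_labelling d (complete_edges (Suc m)) f"
  shows "\<exists>f'. edge_labelling (d + Suc m) (complete_edges (Suc (2 * m))) f'"
proof -
  \<comment> \<open>The \<open>m\<close> later doublings create the vertices \<open>m + 1\<close> to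
    \<open>2 * m\<close>; \<open>z\<close> is the first number beyond them.\<close>
  define z where "z = Suc (2 * m)"
  have "\<exists>f'. edge_labelling (Suc d) (complete_edges (Suc m) \<union> {{z, v} | v. v < m}) f'"
  \<comment> \<open>The copies \<open>m\<close> and \<open>z\<close> are not adjacent, so no word is
    taken over; \<open>Suc z\<close> is just a vertex different from both.\<close>
  proof (rule edge_labelling_split[OF assms, where x = m and x' = z and z = "Suc z"])
    show "(id(z := m)) ` e \<in> complete_edges (Suc m)"
      if "e \<in> complete_edges (Suc m) \<union> {{z, v} | v. v < m}" for e
      using that
    proof
      assume "e \<in> complete_edges (Suc m)"
      then have "\<forall>v\<in>e. v \<noteq> z"
        by (auto simp: complete_edges_def z_def)
      then have "(id(z := m)) ` e = id ` e" by (intro image_cong) auto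
      then show ?thesis using \<open>e \<in> complete_edges (Suc m)\<close> by simp
    next
      assume "e \<in> {{z, v} | v. v < m}"
      then obtain v where "e = {z, v}" "v < m" by auto
      then have "(id(z := m)) ` e = {m, v}" by (auto simp: z_def)
      then show ?thesis
        unfolding complete_edges_def using \<open>v < m\<close>
        by (intro CollectI exI[of _ m] exI[of _ v]) auto
    qed
  qed (auto simp: complete_edges_def z_def doubleton_eq_iff)
  then obtain f' where "edge_labelling (Suc d) (complete_edges (Suc m) \<union> {{z, v} | v. v < m}) f'"
    by blast
  from complete_edges_split_all[OF this] show ?thesis
    by (simp add: z_def mult_2)
qed

lemma edge_labelling_complete:
  "\<exists>f. edge_labelling (2 ^ j + j - 1) (complete_edges (Suc (2 ^ j))) f"
proof (induction j)
  case 0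
  \<comment> \<open>Two vertices span a single edge, so dimension 0 suffices.\<close>
  have "complete_edges (Suc 1) \<subseteq> {{0, 1}}"
    by (auto simp: complete_edges_def less_Suc_eq)
  then have "edge_labelling 0 (complete_edges (Suc 1)) f" for f
    by (auto simp: edge_labelling_def)
  then show ?case by auto
next
  case (Suc j)
  have "2 ^ j + j - 1 + Suc (2 ^ j) = 2 ^ Suc j + Suc j - 1" by simp
  then show ?case using Suc complete_edges_double by (metis power_Suc)
qed

section \<open>Labelling Turan graphs and counting their edges\<close>

text \<open>Vertices \<open>n\<close> and \<open>n - k\<close> lie in the same part, so
  \<open>n\<close> arises by doubling \<open>n - k\<close> with nonadjacent copies.\<close>

lemma edge_labelling_turan_Suc:
  assumes "edge_labelling d (turan_edges n k) f" "k \<le> n" "0 < k"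
  shows "\<exists>f'. edge_labelling (Suc d) (turan_edges (Suc n) k) f'"
proof (rule edge_labelling_split[OF assms(1), where x = "n - k" and x' = n and z = "Suc n"])
  have mod: "(n - k) mod k = n mod k" using assms(2) by (simp add: le_mod_geq)
  show "(id(n := n - k)) ` e \<in> turan_edges n k" if "e \<in> turan_edges (Suc n) k" for e
  proof -
    obtain u v where e: "e = {u, v}" "u < Suc n" "v < Suc n" "u mod k \<noteq> v mod k"
      using \<open>e \<in> turan_edges (Suc n) k\<close> by (auto simp: turan_edges_def)
    let ?u = "(id(n := n - k)) u" and ?v = "(id(n := n - k)) v"
    have "?u < n" "?v < n" "?u mod k \<noteq> ?v mod k" using e assms(2,3) mod by auto
    moreover have "(id(n := n - k)) ` e = {?u, ?v}" using e by simp
    ultimately show ?thesis unfolding turan_edges_def by blast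
  qed
  show "{n - k, n} \<in> turan_edges (Suc n) k \<Longrightarrow> {Suc n, n - k} \<in> turan_edges n k \<and>
      {Suc n, n - k} \<notin> turan_edges (Suc n) k \<and> {Suc n, n} \<notin> turan_edges (Suc n) k"
    using mod by (auto simp: turan_edges_def doubleton_eq_iff)
next
  show "card e = 2" if "e \<in> turan_edges n k" for e
    using that by (auto simp: turan_edges_def card_insert_if)
  show "card e = 2" if "e \<in> turan_edges (Suc n) k" for e
    using that by (auto simp: turan_edges_def card_insert_if)
qed (use assms(2,3) in auto)

lemma edge_labelling_turan:
  "\<exists>f. edge_labelling (2 ^ j + j - 1 + i) (turan_edges (Suc (2 ^ j) + i) (Suc (2 ^ j))) f"
proof (induction i)
  case 0
  have "turan_edges (Suc (2 ^ j)) (Suc (2 ^ j)) = complete_edges (Suc (2 ^ j))"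
    unfolding turan_edges_def complete_edges_def
    by (rule Collect_cong) (metis mod_less)
  then show ?case using edge_labelling_complete by simp
next
  case (Suc i)
  then show ?case using edge_labelling_turan_Suc by fastforce
qed

lemma card_less_cong: "card {v. v < n \<and> v mod k = n mod k} = n div k" if "0 < k" for n k :: nat
proof (induction n rule: less_induct)
  case (less n)
  show ?case
  proof (cases "n < k")
    case True
    then have "{v. v < n \<and> v mod k = n mod k} = {}" by auto
    then show ?thesis using True by simp
  next
    case False
    then have mod: "(n - k) mod k = n mod k" by (simp add: le_mod_geq)
    have last: "v = n - k" if "v < n" "v mod k = n mod k" "\<not> v < n - k" for v
    proof -
      have "k dvd n - v" using that by (metis less_imp_le mod_eq_dvd_iff_nat)
      then have "k \<le> n - v" using that by (simp add: dvd_imp_le)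
      then show ?thesis using that False by linarith
    qed
    have "{v. v < n \<and> v mod k = n mod k} = insert (n - k) {v. v < n - k \<and> v mod k = (n - k) mod k}"
      using mod last False \<open>0 < k\<close> by auto
    then have "card {v. v < n \<and> v mod k = n mod k} = Suc ((n - k) div k)"
      using less[of "n - k"] False \<open>0 < k\<close> by simp
    then show ?thesis using False \<open>0 < k\<close> by (simp add: le_div_geq)
  qed
qed

lemma finite_turan_edges: "finite (turan_edges n k)"
proof (rule finite_subset)
  show "turan_edges n k \<subseteq> Pow {..<n}" by (auto simp: turan_edges_def)
qed simp

text \<open>Vertex \<open>i\<close> is joined to the \<open>i\<close> smaller vertices except the
  \<open>i div k\<close> in its own part.\<close>

lemma card_turan_edges:
  assumes "0 < k"
  shows "card (turan_edges n k) = (\<Sum>i<n. i - i div k)"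
proof (induction n)
  case 0
  have "turan_edges 0 k = {}" by (auto simp: turan_edges_def)
  then show ?case by simp
next
  case (Suc n)
  let ?S = "{v. v < n \<and> v mod k \<noteq> n mod k}"
  have eq: "turan_edges (Suc n) k = turan_edges n k \<union> (\<lambda>v. {n, v}) ` ?S" (is "?L = ?R")
  proof (intro equalityI subsetI)
    fix e assume "e \<in> ?L"
    then obtain u v where e: "e = {u, v}" "u \<le> n" "v \<le> n" "u mod k \<noteq> v mod k"
      by (auto simp: turan_edges_def)
    consider "u < n" "v < n" | "u = n" "v < n" | "u < n" "v = n"
      using e by fastforce
    then show "e \<in> ?R"
    proof cases
      case 1
      then have "e \<in> turan_edges n k" unfolding turan_edges_def using e by blast
      then show ?thesis ..
    next
      case 2
      then have "e = {n, v}" "v \<in> ?S" using e by auto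
      then show ?thesis by blast
    next
      case 3
      then have "e = {n, u}" "u \<in> ?S" using e by auto
      then show ?thesis by blast
    qed
  next
    fix e assume "e \<in> ?R"
    then obtain u v where "e = {u, v}" "u < Suc n" "v < Suc n" "u mod k \<noteq> v mod k"
      by (fastforce simp: turan_edges_def)
    then show "e \<in> ?L" unfolding turan_edges_def by blast
  qed
  have "card ?S = card ({..<n} - {v. v < n \<and> v mod k = n mod k})"
    by (rule arg_cong[where f = card]) auto
  also have "\<dots> = n - n div k"
    using card_less_cong[OF assms, of n] by (subst card_Diff_subset) auto
  finally have "card ?S = n - n div k" .
  moreover have "card ((\<lambda>v. {n, v}) ` ?S) = card ?S"
    by (rule card_image) (auto simp: inj_on_def doubleton_eq_iff)
  moreover have "card ?L = card (turan_edges n k) + card ((\<lambda>v. {n, v}) ` ?S)"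
    unfolding eq
    by (rule card_Un_disjoint)
      (auto simp: finite_turan_edges, auto simp: turan_edges_def doubleton_eq_iff)
  ultimately show ?case using Suc by simp
qed

section \<open>From words to bipartite cliques\<close>

text \<open>Coordinate \<open>i\<close> yields the bipartite clique between the vertices with letter
  0 and those with letter 1 at \<open>i\<close>; it contains an edge iff the words of the ends clash
  at \<open>i\<close>.\<close>

lemma bp2_le_of_words:
  fixes G :: "('a, 'b) pre_digraph" and w :: "'a \<Rightarrow> nat \<Rightarrow> bool option"
  assumes G: "complete_digraph n G"
    and w: "\<And>u v. u \<in> verts G \<Longrightarrow> v \<in> verts G \<Longrightarrow> u \<noteq> v \<Longrightarrow>
      1 \<le> clashes d (w u) (w v) \<and> clashes d (w u) (w v) \<le> 2"
  shows "bp2 G \<le> d"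
proof -
  interpret graph G using G by (simp add: complete_digraph_def)
  have ends_G: "arcs_ends G = {(u, v). (u, v) \<in> verts G \<times> verts G \<and> u \<noteq> v}"
    using G by (simp add: complete_digraph_def)
  define S where "S s i = {v \<in> verts G. w v i = Some s}" for s i
  define H where "H i = \<lparr>verts = S False i \<union> S True i,
    arcs = {e \<in> arcs G. clash (w (tail G e) i) (w (head G e) i)},
    tail = tail G, head = head G\<rparr>" for i
  \<comment> \<open>If a letter is missing at a coordinate, one part would be empty. No words clash
    there, so dropping the coordinate changes no count.\<close>
  define I where "I = {i. i < d \<and> S False i \<noteq> {} \<and> S True i \<noteq> {}}"
  \<comment> \<open>Several coordinates may give the same clique; the multiset counts it once for
    each.\<close>
  define M where "M = image_mset H (mset_set I)"
  have fin_S: "finite (S s i)" for s i by (simp add: S_def)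
  have fin_I: "finite I" by (simp add: I_def)
  have clash_iff: "clash (w u i) (w v i) \<longleftrightarrow> (\<exists>s. w u i = Some s \<and> w v i = Some (\<not> s))" for u v i
    by (cases "w u i"; cases "w v i") (auto simp: clash_def)
  have ends_clash: "(u, v) \<in> arcs_ends (H i) \<longleftrightarrow> (u, v) \<in> arcs_ends G \<and> clash (w u i) (w v i)" for u v i
    by (auto simp: H_def arcs_ends_def arc_to_ends_def image_iff)
  have ends_H: "arcs_ends (H i) = S False i \<times> S True i \<union> S True i \<times> S False i" for i
  proof -
    have "(u, v) \<in> arcs_ends (H i) \<longleftrightarrow> (u, v) \<in> S False i \<times> S True i \<union> S True i \<times> S False i" for u v
      unfolding ends_clash ends_G clash_iff S_def ex_bool_eq by auto
    then show ?thesis by auto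
  qed
  have clique: "bipartite_clique G (H i)" if "i \<in> I" for i
  proof -
    have wf: "wf_digraph (H i)"
      by unfold_locales (auto simp: H_def S_def clash_iff ex_bool_eq)
    then have "subgraph (H i) G"
      using wf_digraph unfolding subgraph_def compatible_def by (auto simp: H_def S_def)
    moreover have "graph (H i)"
    proof -
      have "digraph (H i)"
      proof -
        interpret H: wf_digraph "H i" by fact
        show ?thesis
          by unfold_locales
            (use fin_S no_loops no_multi_arcs in \<open>auto simp: H_def arc_to_ends_def\<close>)
      qed
      moreover have "symmetric (H i)"
        unfolding symmetric_def ends_H by (auto simp: sym_def)
      ultimately show ?thesis by (rule digraph.graphI)
    qed
    then have "complete_bipartite_digraph (card (S False i)) (card (S True i)) (H i)"
      unfolding complete_bipartite_digraph_def ends_H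
      by (intro conjI exI[of _ "S False i"] exI[of _ "S True i"]) (auto simp: H_def S_def)
    moreover have "1 \<le> card (S False i)" "1 \<le> card (S True i)"
      using that fin_S by (auto simp: I_def Suc_le_eq card_gt_0_iff)
    ultimately show ?thesis unfolding bipartite_clique_def by blast
  qed
  have "size {#H \<in># M. e \<in> arcs_ends H#} = clashes d (w (fst e)) (w (snd e))"
    if "e \<in> arcs_ends G" for e
  proof -
    obtain u v where e: "e = (u, v)" by (cases e)
    have "i \<in> I" if "i < d" "clash (w u i) (w v i)" for i
      using that \<open>e \<in> arcs_ends G\<close> unfolding e ends_G clash_iff ex_bool_eq I_def S_def by auto
    then have "{i \<in> I. (u, v) \<in> arcs_ends (H i)} = {i. i < d \<and> clash (w u i) (w v i)}"
      using \<open>e \<in> arcs_ends G\<close> unfolding e ends_clash by (auto simp: I_def)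
    then show ?thesis
      using fin_I by (simp add: M_def filter_mset_image_mset clashes_def e)
  qed
  then have "bipartite_2_covering G M"
    unfolding bipartite_2_covering_def using clique fin_I w by (auto simp: M_def ends_G)
  then have "bp2 G \<le> size M"
    unfolding bp2_def by (intro Least_le) blast
  also have "\<dots> \<le> card {..<d}"
    unfolding M_def size_image_mset size_mset_set by (rule card_mono) (auto simp: I_def)
  finally show ?thesis by simp
qed

lemma bp2_le_of_edge_labelling:
  assumes "complete_digraph (card E) G" "finite E" "edge_labelling d E f"
  shows "bp2 G \<le> d"
proof -
  interpret graph G using assms(1) by (simp add: complete_digraph_def)
  have "card (verts G) = card E" using assms(1) by (simp add: complete_digraph_def)
  then obtain \<phi> where "bij_betw \<phi> (verts G) E"
    using finite_same_card_bij finite_verts assms(2) by blast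
  then have "\<phi> u \<in> E" "\<phi> u \<noteq> \<phi> v" if "u \<in> verts G" "v \<in> verts G" "u \<noteq> v" for u v
    using that by (auto simp: bij_betw_def inj_on_def)
  then show ?thesis
    using assms(3) bp2_le_of_words[OF assms(1), of d "\<lambda>v. f (\<phi> v)"]
    unfolding edge_labelling_def by (metis add_leD1)
qed

section \<open>Edge numbers of Turan graphs with equal parts\<close>

text \<open>For \<open>Suc p\<close> parts of size \<open>q\<close>, each of the
  \<open>Suc p * p\<close> ordered pairs of parts contributes \<open>q\<^sup>2\<close>; the factor 2
  avoids a division.\<close>

lemma sum_turan_mult:
  "2 * (\<Sum>i<q * Suc p. i - i div Suc p) = q\<^sup>2 * (Suc p * p)"
proof (induction q)
  case 0
  then show ?case by simp
next
  case (Suc q)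
  have split: "{..<Suc q * Suc p} = {..<q * Suc p} \<union> (+) (q * Suc p) ` {..<Suc p}"
  proof (intro equalityI subsetI)
    fix i assume "i \<in> {..<Suc q * Suc p}"
    then show "i \<in> {..<q * Suc p} \<union> (+) (q * Suc p) ` {..<Suc p}"
      by (cases "i < q * Suc p") (auto intro!: image_eqI[of _ _ "i - q * Suc p"])
  qed auto
  have "(\<Sum>i<Suc q * Suc p. i - i div Suc p) = (\<Sum>i<q * Suc p. i - i div Suc p) +
      (\<Sum>i<Suc p. (q * Suc p + i) - (q * Suc p + i) div Suc p)"
    unfolding split by (subst sum.union_disjoint) (auto simp: sum.reindex simp del: mult_Suc_right)
  \<comment> \<open>In the last block of \<open>Suc p\<close> summands the quotient is constantly
    \<open>q\<close>.\<close>
  also have "(\<Sum>i<Suc p. (q * Suc p + i) - (q * Suc p + i) div Suc p) = (\<Sum>i<Suc p. q * p + i)"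
  proof (rule sum.cong)
    fix i assume "i \<in> {..<Suc p}"
    then have "(q * Suc p + i) div Suc p = q"
      by (metis div_mult_self3 add.commute div_less lessThan_iff add_0_right nat.distinct(1))
    then show "(q * Suc p + i) - (q * Suc p + i) div Suc p = q * p + i" by simp
  qed simp
  finally have sum: "(\<Sum>i<Suc q * Suc p. i - i div Suc p) =
      (\<Sum>i<q * Suc p. i - i div Suc p) + (\<Sum>i<Suc p. q * p + i)" .
  have "2 * (\<Sum>i<Suc p. q * p + i) = 2 * (Suc p * (q * p)) + Suc p * p"
    using gauss_sum_nat[of p]
    by (simp add: sum.distrib lessThan_Suc_atMost atMost_atLeast0 algebra_simps)
  then have "2 * (\<Sum>i<Suc q * Suc p. i - i div Suc p) =
      q\<^sup>2 * (Suc p * p) + (2 * (Suc p * (q * p)) + Suc p * p)"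
    unfolding sum distrib_left Suc by simp
  also have "\<dots> = (Suc q)\<^sup>2 * (Suc p * p)"
    by (simp add: power2_eq_square algebra_simps)
  finally show ?case .
qed

section \<open>The counting function of the sequence \<open>a\<close>\<close>

lemma finite_three_pow_le: "finite {r. 3 * 2 ^ r \<le> (m::nat)}"
proof (rule finite_subset)
  show "{r. 3 * 2 ^ r \<le> m} \<subseteq> {..m}"
  proof
    fix r assume "r \<in> {r. 3 * 2 ^ r \<le> m}"
    moreover have "r < 2 ^ r" by (rule less_exp)
    ultimately have "r \<le> m" unfolding mem_Collect_eq by linarith
    then show "r \<in> {..m}" by simp
  qed
qed simp

text \<open>For positive \<open>j\<close> the second assumption is
  \<open>3 * 2 ^ (j - 1) \<le> m\<close> without the predecessor; the exponents counted are then
  those below \<open>j\<close>.\<close>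

lemma card_three_pow_le:
  assumes "m < 3 * 2 ^ j" "j = 0 \<or> 3 * 2 ^ j \<le> 2 * m"
  shows "card {r. 3 * 2 ^ r \<le> (m::nat)} = j"
proof -
  have "3 * 2 ^ r \<le> m \<longleftrightarrow> r < j" for r
  proof
    assume "3 * 2 ^ r \<le> m"
    then have "(2::nat) ^ r < 2 ^ j" using assms(1) by linarith
    then show "r < j" by simp
  next
    assume "r < j"
    then have "(2::nat) ^ Suc r \<le> 2 ^ j" by (intro power_increasing) auto
    then show "3 * 2 ^ r \<le> m" using assms(2) \<open>r < j\<close> by auto
  qed
  then show ?thesis by simp
qed

context
  fixes a :: "nat \<Rightarrow> nat"
  assumes a: "is_sequence_a a"
begin

text \<open>Each of the \<open>m - 1\<close> values from 2 to \<open>m\<close> is taken once, and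
  each \<open>3 * 2 ^ r\<close> among them once more.\<close>

lemma card_sequence_le:
  assumes "1 \<le> m"
  shows "finite {n. 1 \<le> n \<and> a n \<le> m} \<and>
    card {n. 1 \<le> n \<and> a n \<le> m} = m - 1 + card {r. 3 * 2 ^ r \<le> m}"
  using assms
proof (induction m rule: nat_induct_at_least)
  case base
  have "{n. 1 \<le> n \<and> a n \<le> 1} = {}"
    using a unfolding is_sequence_a_def by fastforce
  moreover have "{r. 3 * 2 ^ r \<le> (1::nat)} = {}"
    using card_three_pow_le[of 1 0] finite_three_pow_le[of 1] by simp
  ultimately show ?case by (simp only: card.empty finite.emptyI diff_self_eq_0 add_0_right simp_thms)
next
  case (Suc m)
  let ?w = "if \<exists>r. Suc m = 3 * 2 ^ r then 2 else 1"
  have w: "card {n. 1 \<le> n \<and> a n = Suc m} = ?w"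
    using a[unfolded is_sequence_a_def, THEN conjunct2, THEN conjunct2, rule_format, of "Suc m"]
      Suc.hyps by linarith
  \<comment> \<open>An infinite set would have \<open>card\<close> 0, but \<open>?w\<close> is
    positive.\<close>
  then have fin: "finite {n. 1 \<le> n \<and> a n = Suc m}"
    by (intro card_ge_0_finite) (simp split: if_splits)
  have eq: "{n. 1 \<le> n \<and> a n \<le> Suc m} = {n. 1 \<le> n \<and> a n \<le> m} \<union> {n. 1 \<le> n \<and> a n = Suc m}"
    by auto
  have "card {n. 1 \<le> n \<and> a n \<le> Suc m} = card {n. 1 \<le> n \<and> a n \<le> m} + ?w"
    unfolding eq w[symmetric] using fin Suc.IH by (intro card_Un_disjoint) auto
  moreover have "card {r. 3 * 2 ^ r \<le> Suc m} =
      card {r. 3 * 2 ^ r \<le> m} + (if \<exists>r. Suc m = 3 * 2 ^ r then 1 else 0)"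
  proof (cases "\<exists>r. Suc m = 3 * 2 ^ r")
    case True
    then obtain r where r: "Suc m = 3 * 2 ^ r" by auto
    have "{r. 3 * 2 ^ r \<le> Suc m} = insert r {r. 3 * 2 ^ r \<le> m}"
    proof (rule set_eqI)
      fix x
      have "3 * 2 ^ x = Suc m \<longleftrightarrow> x = r" using r by simp
      then show "x \<in> {r. 3 * 2 ^ r \<le> Suc m} \<longleftrightarrow> x \<in> insert r {r. 3 * 2 ^ r \<le> m}"
        by (simp add: le_Suc_eq disj_commute)
    qed
    moreover have "r \<notin> {r. 3 * 2 ^ r \<le> m}" using r by auto
    ultimately show ?thesis using finite_three_pow_le True by simp
  next
    case False
    then have "{r. 3 * 2 ^ r \<le> Suc m} = {r. 3 * 2 ^ r \<le> m}"
      by (auto simp: le_Suc_eq dest: sym)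
    then show ?thesis using False by simp
  qed
  ultimately show ?case using Suc fin eq by simp
qed

text \<open>As \<open>a\<close> is monotone, the indices with value at most \<open>m\<close> form an
  initial segment, determined by its length.\<close>

lemma sequence_le_iff:
  assumes "1 \<le> n" "1 \<le> m"
  shows "a n \<le> m \<longleftrightarrow> n \<le> m - 1 + card {r. 3 * 2 ^ r \<le> m}"
proof -
  let ?S = "{n. 1 \<le> n \<and> a n \<le> m}"
  have mono: "a i \<le> a i'" if "1 \<le> i" "i \<le> i'" for i i'
    using a that unfolding is_sequence_a_def mono_on_def by auto
  have fin: "finite ?S" and card: "card ?S = m - 1 + card {r. 3 * 2 ^ r \<le> m}"
    using card_sequence_le[OF assms(2)] by auto
  have "a n \<le> m \<longleftrightarrow> n \<le> card ?S"
  proof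
    assume "a n \<le> m"
    then have "{1..n} \<subseteq> ?S" using mono order_trans by fastforce
    then have "card {1..n} \<le> card ?S" by (rule card_mono[OF fin])
    then show "n \<le> card ?S" by simp
  next
    assume n: "n \<le> card ?S"
    show "a n \<le> m"
    proof (rule ccontr)
      assume "\<not> a n \<le> m"
      have "i < n" if "1 \<le> i" "a i \<le> m" for i
        using mono[OF assms(1), of i] that \<open>\<not> a n \<le> m\<close> by (cases "i < n") auto
      then have "?S \<subseteq> {1..<n}" by auto
      then have "card ?S \<le> card {1..<n}" by (rule card_mono[rotated]) simp
      then show False using n assms(1) by simp
    qed
  qed
  then show ?thesis using card by simp
qed

section \<open>Matching \<open>b\<close> with the edge numbers of Turan graphs\<close>

text \<open>The left side is the step from \<open>b a d\<close> to \<open>b a (Suc d)\<close>, the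
  right side the degree of the added vertex. With \<open>q = 2 ^ j\<close> and
  \<open>n = d - j\<close>, the quotient is 2 for \<open>n \<le> 3 * q\<close> and 3 beyond; the
  repeated value \<open>3 * q\<close> of \<open>a\<close> occurs on both sides of this jump.\<close>

lemma sequence_eq_turan_increment:
  assumes "2 * 2 ^ j + j \<le> d" "d \<le> 4 * 2 ^ j + j"
  shows "a (d - 1) = (d + 2 - j) - (d + 2 - j) div Suc (2 ^ j)"
proof -
  define q :: nat where "q = 2 ^ j"
  have q: "1 \<le> q" "j = 0 \<or> 2 \<le> q"
    by (simp_all add: q_def) (cases j; simp)
  obtain n where n: "d = n + j" using assms(1) by (metis add_leE le_add_diff_inverse2)
  have bounds: "2 * q \<le> n" "n \<le> 4 * q" using assms n by (simp_all add: q_def)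
  have count: "card {r. 3 * 2 ^ r \<le> m} = j" if "m < 3 * q" "j = 0 \<or> 3 * q \<le> 2 * m" for m :: nat
    using card_three_pow_le that unfolding q_def .
  have count': "card {r. 3 * 2 ^ r \<le> m} = Suc j" if "m < 6 * q" "3 * q \<le> m" for m :: nat
    using card_three_pow_le[of m "Suc j"] that by (simp add: q_def)
  have eqI: "a (d - 1) = m"
    if "2 \<le> m" "m - 2 + card {r. 3 * 2 ^ r \<le> m - 1} < d - 1"
      "d - 1 \<le> m - 1 + card {r. 3 * 2 ^ r \<le> m}" for m
  proof -
    have "1 \<le> d - 1" using that(2) by linarith
    then have "a (d - 1) \<le> m" "\<not> a (d - 1) \<le> m - 1"
      using sequence_le_iff[of "d - 1" m] sequence_le_iff[of "d - 1" "m - 1"] that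
      by (simp_all add: numeral_2_eq_2)
    then show ?thesis by linarith
  qed
  show ?thesis
  proof (cases "n \<le> 3 * q")
    case True
    have "(n + 2) div Suc q = 2"
      using bounds True q by (intro div_nat_eqI) auto
    moreover have "a (d - 1) = n"
    proof (rule eqI)
      show "2 \<le> n" using bounds q by simp
      have "card {r. 3 * 2 ^ r \<le> n - 1} = j"
        using bounds True q by (intro count) auto
      then show "n - 2 + card {r. 3 * 2 ^ r \<le> n - 1} < d - 1"
        using bounds q n by simp
      \<comment> \<open>The count is \<open>j\<close>, except that at \<open>n = 3 * q\<close> the
        exponent \<open>j\<close> is counted too.\<close>
      have "j \<le> card {r. 3 * 2 ^ r \<le> n}"
      proof (cases "n = 3 * q")
        case True
        then show ?thesis using count'[of n] q by simp
      next
        case False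
        then show ?thesis using count[of n] bounds q True by auto
      qed
      then show "d - 1 \<le> n - 1 + card {r. 3 * 2 ^ r \<le> n}"
        using n bounds q by simp
    qed
    ultimately show ?thesis using n by (simp add: q_def)
  next
    case False
    have "(n + 2) div Suc q = 3"
      using bounds False q by (intro div_nat_eqI) auto
    moreover have "a (d - 1) = n - 1"
    proof (rule eqI)
      show "2 \<le> n - 1" using False q by simp
      \<comment> \<open>The count is \<open>Suc j\<close>, except that at
        \<open>n = 3 * q + 1\<close> it is still \<open>j\<close>.\<close>
      have "card {r. 3 * 2 ^ r \<le> n - 1 - 1} \<le> Suc j"
      proof (cases "n - 1 - 1 < 3 * q")
        case True
        moreover have "3 * q \<le> 2 * (n - 1 - 1)" using False q by linarith
        ultimately show ?thesis using count by simp
      next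
        case False
        moreover have "n - 1 - 1 < 6 * q" using bounds q by linarith
        ultimately show ?thesis using count'[of "n - 1 - 1"] by linarith
      qed
      then show "n - 1 - 2 + card {r. 3 * 2 ^ r \<le> n - 1 - 1} < d - 1"
        using False q n by simp
      have "card {r. 3 * 2 ^ r \<le> n - 1} = Suc j"
        using bounds False q by (intro count') auto
      then show "d - 1 \<le> n - 1 - 1 + card {r. 3 * 2 ^ r \<le> n - 1}"
        using False q n by simp
    qed
    ultimately show ?thesis using n by (simp add: q_def)
  qed
qed

text \<open>Within the range of \<open>j\<close> each step adds a vertex; at its end the graph for
  \<open>Suc j\<close> takes over, with one vertex fewer and equally many edges.\<close>

lemma b_eq_turan:
  assumes "2 \<le> d"
  shows "\<exists>j. 2 * 2 ^ j + j \<le> d \<and> d \<le> 4 * 2 ^ j + j \<and>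
    b a d = (\<Sum>i<d + 2 - j. i - i div Suc (2 ^ j))"
  using assms
proof (induction d rule: nat_induct_at_least)
  case base
  \<comment> \<open>The start is \<open>j = 0\<close>: two parts of size 2 span 4 edges.\<close>
  have "x = 4" if "2 * x = 2\<^sup>2 * (Suc 1 * 1)" for x :: nat
    using that by simp
  from this[OF sum_turan_mult] have "b a 2 = (\<Sum>i<2 * Suc 1. i - i div Suc 1)"
    by (simp only: b_def) simp
  then show ?case by (intro exI[of _ 0]) simp
next
  case (Suc d)
  then obtain j where j: "2 * 2 ^ j + j \<le> d" "d \<le> 4 * 2 ^ j + j"
    and b: "b a d = (\<Sum>i<d + 2 - j. i - i div Suc (2 ^ j))" by blast
  obtain e where e: "d = Suc (Suc e)" using Suc.hyps by (metis add_2_eq_Suc le_Suc_ex)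
  have "b a (Suc d) = b a d + a (d - 1)" by (simp add: b_def e)
  also have "\<dots> = (\<Sum>i<Suc (d + 2 - j). i - i div Suc (2 ^ j))"
    using b sequence_eq_turan_increment[OF j] by simp
  also have "Suc (d + 2 - j) = Suc d + 2 - j" using j by simp
  finally have b': "b a (Suc d) = (\<Sum>i<Suc d + 2 - j. i - i div Suc (2 ^ j))" .
  show ?case
  proof (cases "Suc d \<le> 4 * 2 ^ j + j")
    case True
    then show ?thesis using j b' by (intro exI[of _ j]) auto
  next
    case False
    define p :: nat where "p = 2 ^ j"
    have d: "d = 4 * p + j" using j False by (simp add: p_def)
    \<comment> \<open>One more vertex would make all parts have size 4; its summand is
      \<open>4 * p + 3 - 3\<close>. Both edge numbers compared below are
      \<open>4 * p * (2 * p + 1)\<close>.\<close>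
    have "(4 * p + 3) div Suc p = 3" by (intro div_nat_eqI) auto
    then have "(\<Sum>i<4 * Suc p. i - i div Suc p) = (\<Sum>i<4 * p + 3. i - i div Suc p) + 4 * p"
      by (simp add: eval_nat_numeral)
    then have "2 * (\<Sum>i<4 * p + 3. i - i div Suc p) + 8 * p = 16 * (Suc p * p)"
      using sum_turan_mult[where q = 4 and p = p] by simp
    moreover have "2 * (\<Sum>i<2 * Suc (2 * p). i - i div Suc (2 * p)) = 4 * (Suc (2 * p) * (2 * p))"
      using sum_turan_mult[where q = 2 and p = "2 * p"] by simp
    ultimately have "(\<Sum>i<4 * p + 3. i - i div Suc p) =
        (\<Sum>i<2 * Suc (2 * p). i - i div Suc (2 * p))"
      by (simp add: algebra_simps)
    moreover have "Suc d + 2 - j = 4 * p + 3" "Suc d + 2 - Suc j = 2 * Suc (2 * p)"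
      using d by simp_all
    ultimately have "b a (Suc d) = (\<Sum>i<Suc d + 2 - Suc j. i - i div Suc (2 ^ Suc j))"
      using b' by (simp add: p_def)
    then show ?thesis
      using d by (intro exI[of _ "Suc j"]) (simp add: p_def)
  qed
qed

end

theorem theorem5:
  fixes a :: "nat \<Rightarrow> nat" and d :: nat and G :: "('a, 'b) pre_digraph"
  assumes "is_sequence_a a"
    and "d \<ge> 2"
    and "complete_digraph (b a d) G"
  shows "bp2 G \<le> d"
proof -
  obtain j where j: "2 * 2 ^ j + j \<le> d" "d \<le> 4 * 2 ^ j + j"
    and b: "b a d = (\<Sum>i<d + 2 - j. i - i div Suc (2 ^ j))"
    using b_eq_turan[OF assms(1,2)] by blast
  \<comment> \<open>The number of doublings, at one coordinate each, from \<open>2 ^ j + 1\<close>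
    to \<open>d + 2 - j\<close> vertices; \<open>2 * 2 ^ j + j \<le> d\<close> prevents
    truncation.\<close>
  define i where "i = d + 1 - j - 2 ^ j"
  have "Suc (2 ^ j) + i = d + 2 - j"
    unfolding i_def using j by linarith
  moreover from this have "2 ^ j + j - 1 + i = d"
    using j one_le_power[of "2::nat" j] by linarith
  ultimately obtain f where "edge_labelling d (turan_edges (d + 2 - j) (Suc (2 ^ j))) f"
    using edge_labelling_turan[of j i] by auto
  moreover have "complete_digraph (card (turan_edges (d + 2 - j) (Suc (2 ^ j)))) G"
    using assms(3) b by (simp add: card_turan_edges)
  ultimately show ?thesis
    using bp2_le_of_edge_labelling finite_turan_edges by blast
qed

end
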